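(* Let $n\ge2$, let $K\subseteq\mathbb{R}^n$ be convex with nonempty interior, and let $a,b,c,d\in\operatorname{int}K$ be (distinct) collinear points with $(a,b;c,d)=-1$. Then $K\models\operatorname{Harm}(a,b;c,d)$, with quadrangle witnesses $P,X,Y,Z\in\operatorname{int}K$. Consequently, on quadruples of collinear interior points of $K$, the $\mathcal{L}_{\mathrm{B}}$-formula $\operatorname{Harm}$ defines exactly the harmonic quadruples, uniformly in $K$ and in $n$.
   Context: $\mathcal{L}_{\mathrm{B}}$ is the first-order language with a single ternary relation symbol $B$. A convex set $K\subseteq\mathbb{R}^n$ is an $\mathcal{L}_{\mathrm{B}}$-structure with universe $K$ (all quantifiers range over $K$), where $B(a,x,b)$ holds iff $x\in[a,b]$. Cross-ratio: for distinct collinear points $a,b,c,d$ with parameters $\alpha,\beta,\gamma,\delta$ under an affine parametrization of their line, $(a,b;c,d)=\frac{(\gamma-\alpha)(\delta-\beta)}{(\gamma-\beta)(\delta-\alpha)}$; the quadruple is harmonic if $(a,b;c,d)=-1$. Formulas: $\operatorname{Coll}(x,y,z):\equiv B(x,y,z)\vee B(y,x,z)\vee B(x,z,y)$. $\mathrm{Quad}(P,X,Y,Z)$ says that $P,X,Y,Z$ are pairwise distinct and no three of them are collinear (a conjunction of $\neq$ and $\neg\operatorname{Coll}$ clauses). Then $$\operatorname{Harm}(a,b;c,d):\equiv a\ne b\wedge c\ne a\wedge c\ne b\wedge\operatorname{Coll}(a,b,c)\wedge\operatorname{Coll}(a,b,d)\wedge\exists P\,X\,Y\,Z\,\bigl[\mathrm{Quad}(P,X,Y,Z)\wedge\operatorname{Coll}(a,P,X)\wedge\operatorname{Coll}(b,P,Y)\wedge\operatorname{Coll}(c,X,Y)\wedge\operatorname{Coll}(a,Y,Z)\wedge\operatorname{Coll}(b,X,Z)\wedge\operatorname{Coll}(d,P,Z)\wedge\neg\operatorname{Coll}(a,b,P)\bigr].$$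 "Quadrangle witnesses" are values of $P,X,Y,Z$ satisfying the bracketed clause. *)

theory Defs
  imports "HOL-Analysis.Analysis"
begin

section \<open>The first-order language with one ternary relation symbol\<close>

text \<open>Variables are natural numbers; \<open>Bet x y z\<close> is the atomic formula \<open>B(x,y,z)\<close>.\<close>

datatype lb_formula =
    Eq nat nat
  | Bet nat nat nat
  | Neg lb_formula
  | Conj lb_formula lb_formula (infixr "\<^bold>\<and>" 35)
  | Disj lb_formula lb_formula (infixr "\<^bold>\<or>" 30)
  | Exi nat lb_formula

fun free_vars :: "lb_formula \<Rightarrow> nat set" where
  "free_vars (Eq x y) = {x, y}"
| "free_vars (Bet x y z) = {x, y, z}"
| "free_vars (Neg \<phi>) = free_vars \<phi>"
| "free_vars (\<phi> \<^bold>\<and> \<psi>) = free_vars \<phi> \<union> free_vars \<psi>"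
| "free_vars (\<phi> \<^bold>\<or> \<psi>) = free_vars \<phi> \<union> free_vars \<psi>"
| "free_vars (Exi x \<phi>) = free_vars \<phi> - {x}"

fun sat :: "'a::real_vector set \<Rightarrow> (nat \<Rightarrow> 'a) \<Rightarrow> lb_formula \<Rightarrow> bool" where
  "sat K s (Eq x y) \<longleftrightarrow> s x = s y"
| "sat K s (Bet x y z) \<longleftrightarrow> s y \<in> closed_segment (s x) (s z)"
| "sat K s (Neg \<phi>) \<longleftrightarrow> \<not> sat K s \<phi>"
| "sat K s (\<phi> \<^bold>\<and> \<psi>) \<longleftrightarrow> sat K s \<phi> \<and> sat K s \<psi>"
| "sat K s (\<phi> \<^bold>\<or> \<psi>) \<longleftrightarrow> sat K s \<phi> \<or> sat K s \<psi>"
| "sat K s (Exi x \<phi>) \<longleftrightarrow> (\<exists>u\<in>K. sat K (s(x := u)) \<phi>)"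

lemma sat_cong:
  assumes "\<And>x. x \<in> free_vars \<phi> \<Longrightarrow> s x = t x"
  shows "sat K s \<phi> \<longleftrightarrow> sat K t \<phi>"
  using assms
proof (induction \<phi> arbitrary: s t)
  case (Exi x \<phi>)
  have "sat K (s(x := u)) \<phi> \<longleftrightarrow> sat K (t(x := u)) \<phi>" for u
    by (rule Exi.IH) (use Exi.prems in auto)
  then show ?case by simp
next
  case (Neg \<phi>)
  then show ?case by (metis free_vars.simps(3) sat.simps(3))
next
  case (Conj \<phi> \<psi>)
  then show ?case by (metis UnCI free_vars.simps(4) sat.simps(4))
next
  case (Disj \<phi> \<psi>)
  then show ?case by (metis UnCI free_vars.simps(5) sat.simps(5))
qed auto

text \<open>The list \<open>as\<close> interprets the variables \<open>0, \<dots>, length as - 1\<close>. It is meant for formulas whose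
  free variables are among these; by \<open>sat_cong\<close> the values of \<open>(!) as\<close> beyond the end of the list
  are then irrelevant.\<close>

definition models :: "'a::real_vector set \<Rightarrow> lb_formula \<Rightarrow> 'a list \<Rightarrow> bool" where
  "models K \<phi> as \<longleftrightarrow> sat K ((!) as) \<phi>"

section \<open>The formula Harm\<close>

definition Coll :: "nat \<Rightarrow> nat \<Rightarrow> nat \<Rightarrow> lb_formula" where
  "Coll x y z = (Bet x y z \<^bold>\<or> Bet y x z \<^bold>\<or> Bet x z y)"

definition Quad :: "nat \<Rightarrow> nat \<Rightarrow> nat \<Rightarrow> nat \<Rightarrow> lb_formula" where
  "Quad P X Y Z =
    (Neg (Eq P X) \<^bold>\<and> Neg (Eq P Y) \<^bold>\<and> Neg (Eq P Z) \<^bold>\<and> Neg (Eq X Y) \<^bold>\<and> Neg (Eq X Z) \<^bold>\<and> Neg (Eq Y Z) \<^bold>\<and>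
     Neg (Coll P X Y) \<^bold>\<and> Neg (Coll P X Z) \<^bold>\<and> Neg (Coll P Y Z) \<^bold>\<and> Neg (Coll X Y Z))"

text \<open>The free variables \<open>a, b, c, d\<close> are \<open>0, 1, 2, 3\<close>, and \<open>P, X, Y, Z\<close> are \<open>4, 5, 6, 7\<close>.\<close>

definition Harm_matrix :: lb_formula where
  "Harm_matrix =
    (let a = 0; b = 1; c = 2; d = 3; P = 4; X = 5; Y = 6; Z = 7 in
      Quad P X Y Z \<^bold>\<and> Coll a P X \<^bold>\<and> Coll b P Y \<^bold>\<and> Coll c X Y \<^bold>\<and>
      Coll a Y Z \<^bold>\<and> Coll b X Z \<^bold>\<and> Coll d P Z \<^bold>\<and> Neg (Coll a b P))"

definition Harm :: lb_formula where
  "Harm =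
    (let a = 0; b = 1; c = 2; d = 3; P = 4; X = 5; Y = 6; Z = 7 in
      Neg (Eq a b) \<^bold>\<and> Neg (Eq c a) \<^bold>\<and> Neg (Eq c b) \<^bold>\<and> Coll a b c \<^bold>\<and> Coll a b d \<^bold>\<and>
      Exi P (Exi X (Exi Y (Exi Z Harm_matrix))))"

lemma free_vars_Coll: "free_vars (Coll x y z) = {x, y, z}"
  unfolding Coll_def free_vars.simps by blast

lemma free_vars_Quad: "free_vars (Quad P X Y Z) = {P, X, Y, Z}"
  unfolding Quad_def free_vars.simps free_vars_Coll by blast

lemma free_vars_Harm_matrix: "free_vars Harm_matrix = {0, 1, 2, 3, 4, 5, 6, 7}"
  unfolding Harm_matrix_def Let_def free_vars.simps free_vars_Coll free_vars_Quad by blast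

lemma free_vars_Harm: "free_vars Harm = {0, 1, 2, 3}"
proof -
  have "{0, 1, 2, 3, 4, 5, 6, 7} - {7} - {6} - {5} - {4} = {0, 1, 2, 3 :: nat}"
    by (simp add: insert_Diff_if)
  then show ?thesis
    unfolding Harm_def Let_def free_vars.simps free_vars_Coll free_vars_Harm_matrix by auto
qed

section \<open>Cross-ratio and harmonic quadruples\<close>

text \<open>Meaningful for distinct collinear points only, where the value does not depend on the affine
  parametrization \<open>t \<mapsto> p + t v\<close> of the line (lemma \<open>cross_ratio_param\<close>).\<close>

definition cross_ratio :: "'a::real_vector \<Rightarrow> 'a \<Rightarrow> 'a \<Rightarrow> 'a \<Rightarrow> real" where
  "cross_ratio a b c d =
    (THE r. \<exists>p v \<alpha> \<beta> \<gamma> \<delta>. v \<noteq> 0 \<and>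
      a = p + \<alpha> *\<^sub>R v \<and> b = p + \<beta> *\<^sub>R v \<and> c = p + \<gamma> *\<^sub>R v \<and> d = p + \<delta> *\<^sub>R v \<and>
      r = ((\<gamma> - \<alpha>) * (\<delta> - \<beta>)) / ((\<gamma> - \<beta>) * (\<delta> - \<alpha>)))"

lemma cross_ratio_param:
  fixes p v :: "'a::real_vector"
  assumes v: "v \<noteq> 0" and ne: "distinct [\<alpha>, \<beta>, \<gamma>, \<delta>]"
  shows "cross_ratio (p + \<alpha> *\<^sub>R v) (p + \<beta> *\<^sub>R v) (p + \<gamma> *\<^sub>R v) (p + \<delta> *\<^sub>R v) =
    ((\<gamma> - \<alpha>) * (\<delta> - \<beta>)) / ((\<gamma> - \<beta>) * (\<delta> - \<alpha>))"
  unfolding cross_ratio_def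
proof (rule the_equality, goal_cases)
  case 1
  show ?case using v by blast
next
  case (2 r)
  then obtain q w \<alpha>' \<beta>' \<gamma>' \<delta>' where w: "w \<noteq> 0"
    and a: "p + \<alpha> *\<^sub>R v = q + \<alpha>' *\<^sub>R w" and b: "p + \<beta> *\<^sub>R v = q + \<beta>' *\<^sub>R w"
    and c: "p + \<gamma> *\<^sub>R v = q + \<gamma>' *\<^sub>R w" and d: "p + \<delta> *\<^sub>R v = q + \<delta>' *\<^sub>R w"
    and r: "r = ((\<gamma>' - \<alpha>') * (\<delta>' - \<beta>')) / ((\<gamma>' - \<beta>') * (\<delta>' - \<alpha>'))" by blast
  have diff: "(x - y) *\<^sub>R v = (x' - y') *\<^sub>R w"
    if "p + x *\<^sub>R v = q + x' *\<^sub>R w" "p + y *\<^sub>R v = q + y' *\<^sub>R w" for x y x' y'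
  proof -
    have "(p + x *\<^sub>R v) - (p + y *\<^sub>R v) = (q + x' *\<^sub>R w) - (q + y' *\<^sub>R w)"
      by (simp only: that)
    then show ?thesis by (simp add: scaleR_diff_left)
  qed
  define k where "k = (\<beta>' - \<alpha>') / (\<beta> - \<alpha>)"
  have "(\<beta> - \<alpha>) *\<^sub>R v = (\<beta> - \<alpha>) *\<^sub>R (k *\<^sub>R w)"
    using diff[OF b a] ne by (simp add: k_def)
  moreover have "\<beta> - \<alpha> \<noteq> 0" using ne by simp
  ultimately have vk: "v = k *\<^sub>R w" by (rule scaleR_left_imp_eq[rotated])
  with v have k: "k \<noteq> 0" by auto
  have scale: "x' - y' = k * (x - y)"
    if "p + x *\<^sub>R v = q + x' *\<^sub>R w" "p + y *\<^sub>R v = q + y' *\<^sub>R w" for x y x' y'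
  proof -
    have "(k * (x - y)) *\<^sub>R w = (x' - y') *\<^sub>R w"
      using diff[OF that] by (simp only: vk scaleR_scaleR mult.commute)
    with w show ?thesis by simp
  qed
  have cancel: "((k * A) * (k * B)) / ((k * C) * (k * D)) = (A * B) / (C * D)" for A B C D
    using k by simp
  show ?case
    unfolding r scale[OF c a] scale[OF d b] scale[OF c b] scale[OF d a]
    by (rule cancel)
qed

definition harmonic :: "'a::real_vector \<Rightarrow> 'a \<Rightarrow> 'a \<Rightarrow> 'a \<Rightarrow> bool" where
  "harmonic a b c d \<longleftrightarrow>
    distinct [a, b, c, d] \<and> collinear {a, b, c, d} \<and> cross_ratio a b c d = -1"

end

theory Submission
  imports Defs
begin

text \<open>
  In affine coordinates with \<open>a = (0, 0)\<close>, \<open>b = (1, 0)\<close>, \<open>c = (\<gamma>, 0)\<close>, \<open>d = (\<delta>, 0)\<close>, the quadruple is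
  harmonic iff \<open>2 \<gamma> \<delta> = \<gamma> + \<delta>\<close>. Given a harmonic quadruple, the complete quadrangle can be taken
  inside an arbitrarily small neighbourhood of \<open>d\<close>: put \<open>P = (\<delta>, t h)\<close> and \<open>Z = (\<delta>, h)\<close>, and let
  \<open>X = aP \<inter> bZ\<close> and \<open>Y = bP \<inter> aZ\<close>; all four points tend to \<open>d\<close> as \<open>t \<rightarrow> 1\<close> and \<open>h \<rightarrow> 0\<close>.
  Conversely, \<open>P\<close> lies off the line \<open>ab\<close>, so \<open>a, b, P\<close> is an affine frame of a plane containing any
  quadrangle of witnesses, and the incidences become polynomial equations that force
  \<open>2 \<gamma> \<delta> = \<gamma> + \<delta>\<close>.
\<close>

section \<open>Satisfaction of the formulas as incidence geometry\<close>

definition harm_config ::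
    "'a::real_vector \<Rightarrow> 'a \<Rightarrow> 'a \<Rightarrow> 'a \<Rightarrow> 'a \<Rightarrow> 'a \<Rightarrow> 'a \<Rightarrow> 'a \<Rightarrow> bool" where
  "harm_config a b c d P X Y Z \<longleftrightarrow>
    \<not> collinear {P, X, Y} \<and> \<not> collinear {P, X, Z} \<and> \<not> collinear {P, Y, Z} \<and> \<not> collinear {X, Y, Z} \<and>
    collinear {a, P, X} \<and> collinear {b, P, Y} \<and> collinear {c, X, Y} \<and>
    collinear {a, Y, Z} \<and> collinear {b, X, Z} \<and> collinear {d, P, Z} \<and> \<not> collinear {a, b, P}"

lemma sat_Coll:
  fixes s :: "nat \<Rightarrow> 'a::euclidean_space"
  shows "sat K s (Coll x y z) \<longleftrightarrow> collinear {s x, s y, s z}"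
  unfolding Coll_def sat.simps collinear_between_cases between_mem_segment
  by (auto simp: closed_segment_commute)

text \<open>The matrix is quantifier-free, so its truth is independent of \<open>K\<close>; the
  structure enters \<open>Harm\<close> only through the range of the four quantified points.\<close>

lemma sat_Harm_matrix:
  fixes s :: "nat \<Rightarrow> 'a::euclidean_space"
  shows "sat K s Harm_matrix \<longleftrightarrow> harm_config (s 0) (s 1) (s 2) (s 3) (s 4) (s 5) (s 6) (s 7)"
proof -
  \<comment> \<open>Two points are always collinear, so the four non-collinear triples of
    \<open>harm_config\<close> already carry the distinctness clauses of
    \<open>Quad\<close>.\<close>
  have "x \<noteq> y \<and> x \<noteq> z \<and> y \<noteq> z" if "\<not> collinear {x, y, z}" for x y z :: 'a
    using that by (auto simp: insert_commute)
  then show ?thesis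
    unfolding Harm_matrix_def Let_def Quad_def sat.simps sat_Coll harm_config_def by blast
qed

lemma models_Harm_matrix:
  fixes a b c d P X Y Z :: "'a::euclidean_space"
  shows "models K Harm_matrix [a, b, c, d, P, X, Y, Z] \<longleftrightarrow> harm_config a b c d P X Y Z"
  by (simp add: models_def sat_Harm_matrix)

lemma models_Harm:
  fixes a b c d :: "'a::euclidean_space"
  shows "models K Harm [a, b, c, d] \<longleftrightarrow>
    a \<noteq> b \<and> c \<noteq> a \<and> c \<noteq> b \<and> collinear {a, b, c} \<and> collinear {a, b, d} \<and>
    (\<exists>P\<in>K. \<exists>X\<in>K. \<exists>Y\<in>K. \<exists>Z\<in>K. harm_config a b c d P X Y Z)"
  by (simp add: models_def Harm_def Let_def sat_Coll sat_Harm_matrix)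

section \<open>Collinearity in affine coordinates\<close>

lemma collinear_3_param:
  fixes x y z :: "'a::real_vector"
  assumes "collinear {x, y, z}" "x \<noteq> y"
  obtains t where "z = x + t *\<^sub>R (y - x)"
proof -
  have "collinear {0, y - x, z - x}"
    using assms(1) collinear_3[of y x z] by (simp add: insert_commute)
  then consider "z - x = 0" | c where "z - x = c *\<^sub>R (y - x)"
    using assms(2) by (auto simp: collinear_lemma)
  then show thesis
  proof cases
    case 1
    then show thesis using that[of 0] by simp
  next
    case (2 c)
    then show thesis using that[of c] by (simp add: algebra_simps)
  qed
qed

lemma not_collinear_imp_frame:
  fixes a b p :: "'a::real_vector"
  assumes "\<not> collinear {a, b, p}"
  shows "\<forall>x y. x *\<^sub>R (b - a) + y *\<^sub>R (p - a) = 0 \<longrightarrow> x = 0 \<and> y = 0"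
proof (intro allI impI)
  fix x y :: real
  assume eq: "x *\<^sub>R (b - a) + y *\<^sub>R (p - a) = 0"
  have nc: "\<not> collinear {0, b - a, p - a}"
    using assms collinear_3[of b a p] by (simp add: insert_commute)
  have "y = 0"
  proof (rule ccontr)
    assume y: "y \<noteq> 0"
    have "y *\<^sub>R (p - a) = y *\<^sub>R ((- x / y) *\<^sub>R (b - a))"
      using eq y by (simp add: eq_neg_iff_add_eq_0 add.commute)
    with y have "p - a = (- x / y) *\<^sub>R (b - a)" by (simp only: scaleR_cancel_left) simp
    then have "collinear {0, b - a, p - a}" unfolding collinear_lemma by blast
    with nc show False ..
  qed
  with eq nc show "x = 0 \<and> y = 0" by (auto simp: collinear_lemma)
qed

lemma frame_point_eq_iff:
  fixes q v w :: "'a::real_vector"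
  assumes "\<forall>x y. x *\<^sub>R v + y *\<^sub>R w = 0 \<longrightarrow> x = 0 \<and> y = 0"
  shows "q + x *\<^sub>R v + y *\<^sub>R w = q + x' *\<^sub>R v + y' *\<^sub>R w \<longleftrightarrow> x = x' \<and> y = y'"
  using assms[rule_format, of "x - x'" "y - y'"] by (auto simp: algebra_simps)

text \<open>Collinearity is the vanishing of the determinant of two difference vectors. The
  division-free form turns every incidence into a polynomial identity.\<close>

lemma collinear_frame_iff:
  fixes q v w :: "'a::real_vector"
  assumes indep: "\<forall>x y. x *\<^sub>R v + y *\<^sub>R w = 0 \<longrightarrow> x = 0 \<and> y = 0"
  shows "collinear {q + x1 *\<^sub>R v + y1 *\<^sub>R w, q + x2 *\<^sub>R v + y2 *\<^sub>R w, q + x3 *\<^sub>R v + y3 *\<^sub>R w}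
    \<longleftrightarrow> (x2 - x1) * (y3 - y1) = (x3 - x1) * (y2 - y1)"
    (is "collinear {?p1, ?p2, ?p3} \<longleftrightarrow> ?det")
proof -
  note eq_iff = frame_point_eq_iff[OF indep]
  show ?thesis
  proof (cases "x1 = x2 \<and> y1 = y2")
    case True
    then show ?thesis by simp
  next
    case False
    then have ne: "?p1 \<noteq> ?p2" by (simp add: eq_iff)
    have param: "?p1 + t *\<^sub>R (?p2 - ?p1)
        = q + (x1 + t * (x2 - x1)) *\<^sub>R v + (y1 + t * (y2 - y1)) *\<^sub>R w" for t
      by (simp add: algebra_simps)
    show ?thesis
    proof
      assume "collinear {?p1, ?p2, ?p3}"
      then obtain t where "?p3 = ?p1 + t *\<^sub>R (?p2 - ?p1)"
        using ne by (rule collinear_3_param)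
      then have "x3 = x1 + t * (x2 - x1)" "y3 = y1 + t * (y2 - y1)"
        unfolding param eq_iff by auto
      then show ?det by simp
    next
      assume det: ?det
      \<comment> \<open>The parameter is read off a coordinate in which the first two points differ;
        the determinant settles the other coordinate.\<close>
      have "\<exists>t. x3 = x1 + t * (x2 - x1) \<and> y3 = y1 + t * (y2 - y1)"
      proof (cases "x1 = x2")
        case True
        with False det show ?thesis
          by (intro exI[of _ "(y3 - y1) / (y2 - y1)"]) auto
      next
        case False
        with det show ?thesis
          by (intro exI[of _ "(x3 - x1) / (x2 - x1)"]) (simp add: field_simps)
      qed
      then obtain t where "?p3 = ?p1 + t *\<^sub>R (?p2 - ?p1)"
        unfolding param eq_iff by blast
      then have "?p3 - ?p1 = t *\<^sub>R (?p2 - ?p1)" by simp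
      then have "collinear {0, ?p2 - ?p1, ?p3 - ?p1}"
        unfolding collinear_lemma by blast
      then show "collinear {?p1, ?p2, ?p3}"
        using collinear_3[of ?p2 ?p1 ?p3] by (simp add: insert_commute)
    qed
  qed
qed

text \<open>At parameters 0, 1, \<gamma>, \<delta> the cross-ratio is
  \<open>\<gamma> * (\<delta> - 1) / ((\<gamma> - 1) * \<delta>)\<close>; equate it to -1 and clear
  denominators.\<close>

lemma harmonic_param_iff:
  fixes a v :: "'a::real_vector"
  assumes v: "v \<noteq> 0"
  shows "harmonic a (a + v) (a + \<gamma> *\<^sub>R v) (a + \<delta> *\<^sub>R v) \<longleftrightarrow>
    distinct [0, 1, \<gamma>, \<delta>] \<and> 2 * \<gamma> * \<delta> = \<gamma> + \<delta>"
proof -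
  let ?p = "\<lambda>t. a + t *\<^sub>R v"
  have pts: "?p 0 = a" "?p 1 = a + v" by simp_all
  have inj: "?p s = ?p t \<longleftrightarrow> s = t" for s t using v by simp
  have "distinct [?p 0, ?p 1, ?p \<gamma>, ?p \<delta>] \<longleftrightarrow> distinct [0, 1, \<gamma>, \<delta>]"
    by (simp only: distinct.simps list.set insert_iff empty_iff inj)
  moreover have "collinear {?p 0, ?p 1, ?p \<gamma>, ?p \<delta>}"
    unfolding collinear_alt by (rule exI[of _ a], rule exI[of _ v]) (auto intro: exI[of _ 1])
  moreover have "cross_ratio (?p 0) (?p 1) (?p \<gamma>) (?p \<delta>) = -1 \<longleftrightarrow> 2 * \<gamma> * \<delta> = \<gamma> + \<delta>"
    if "distinct [0, 1, \<gamma>, \<delta>]"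
    using that unfolding cross_ratio_param[OF v that] by (auto simp: field_simps)
  ultimately show ?thesis unfolding harmonic_def pts by blast
qed

section \<open>From a quadrangle to harmonicity\<close>

text \<open>In the frame \<open>a, b, P\<close>, the lines \<open>aP\<close>, \<open>bP\<close> and
  \<open>aY\<close> parametrize \<open>X\<close>, \<open>Y\<close> and \<open>Z\<close> by
  \<open>x\<close>, \<open>y\<close> and \<open>s\<close>. The three remaining incidences give
  equations from which these parameters are eliminated.\<close>

lemma quadrangle_imp_harmonic:
  fixes a b c d :: "'a::real_vector"
  assumes "c \<noteq> a" "c \<noteq> b" "collinear {a, b, c}" "collinear {a, b, d}"
    and config: "harm_config a b c d P X Y Z"
  shows "harmonic a b c d"
proof -
  have nc: "\<not> collinear {a, b, P}" using config by (simp add: harm_config_def)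
  then have ne: "a \<noteq> b" "a \<noteq> P" "P \<noteq> b" by (auto simp: insert_commute)
  \<comment> \<open>\<open>Y = a\<close> would put \<open>P\<close> on the line \<open>ab\<close>.
    The line \<open>aY\<close> is used below to parametrize \<open>Z\<close>.\<close>
  have "a \<noteq> Y" using config nc by (auto simp: harm_config_def insert_commute)
  define v w where "v = b - a" and "w = P - a"
  note indep = not_collinear_imp_frame[OF nc, folded v_def w_def]
  let ?pt = "\<lambda>x y. a + x *\<^sub>R v + y *\<^sub>R w"
  have v: "v \<noteq> 0" using ne by (simp add: v_def)
  have coords: "a = ?pt 0 0" "b = ?pt 1 0" "P = ?pt 0 1" by (simp_all add: v_def w_def)
  obtain \<gamma> where "c = a + \<gamma> *\<^sub>R (b - a)" using assms(3) ne(1) by (rule collinear_3_param)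
  then have c: "c = ?pt \<gamma> 0" by (simp add: v_def)
  obtain \<delta> where "d = a + \<delta> *\<^sub>R (b - a)" using assms(4) ne(1) by (rule collinear_3_param)
  then have d: "d = ?pt \<delta> 0" by (simp add: v_def)
  obtain x where "X = a + x *\<^sub>R (P - a)"
    using config ne(2) unfolding harm_config_def by (blast elim: collinear_3_param)
  then have X: "X = ?pt 0 x" by (simp add: w_def)
  have "collinear {P, b, Y}" using config by (simp add: harm_config_def insert_commute)
  then obtain y where "Y = P + y *\<^sub>R (b - P)" using ne(3) by (rule collinear_3_param)
  then have Y: "Y = ?pt y (1 - y)" by (simp add: v_def w_def algebra_simps)
  obtain s where "Z = a + s *\<^sub>R (Y - a)"
    using config \<open>a \<noteq> Y\<close> unfolding harm_config_def by (blast elim: collinear_3_param)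
  then have Z: "Z = ?pt (s * y) (s * (1 - y))" unfolding Y by (simp add: algebra_simps)
  note det = collinear_frame_iff[OF indep]
  have nondeg: "\<not> collinear {P, X, Z}" "\<not> collinear {X, Y, Z}"
    and inc: "collinear {b, X, Z}" "collinear {c, X, Y}" "collinear {d, P, Z}"
    using config by (simp_all add: harm_config_def)
  \<comment> \<open>Up to sign, the two determinants are \<open>s * y * (x - 1)\<close> and
    \<open>x * y * (s - 1)\<close>.\<close>
  have x0: "x \<noteq> 0" and y0: "y \<noteq> 0" and s0: "s \<noteq> 0"
    using nondeg unfolding coords(3) X Y Z det by (auto simp: algebra_simps)
  have bXZ: "s * (x * y + 1 - y) = x"
    using inc(1) unfolding coords(2) X Z det by (simp add: algebra_simps)
  have cXY: "\<gamma> * (x + y - 1) = x * y"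
    using inc(2) unfolding c X Y det by (simp add: algebra_simps)
  have dPZ: "\<delta> * (1 - s * (1 - y)) = s * y"
    using inc(3) unfolding d coords(3) Z det by (simp add: algebra_simps)
  \<comment> \<open>Eliminates \<open>s\<close>: by \<open>bXZ\<close>, \<open>x\<close> times the
    left side of \<open>dPZ\<close> is a multiple of \<open>s\<close>, which then cancels.\<close>
  have "\<delta> * (1 - y - x + 2 * x * y) = x * y"
  proof -
    have "s * (\<delta> * (1 - y - x + 2 * x * y)) = s * (x * y)"
    proof -
      have "s * (1 - y - x + 2 * x * y) = x * (1 - s * (1 - y))"
        using bXZ by (simp add: algebra_simps)
      then have "s * (\<delta> * (1 - y - x + 2 * x * y)) = x * (\<delta> * (1 - s * (1 - y)))"
        by simp
      then show ?thesis by (simp add: dPZ)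
    qed
    with s0 show ?thesis by simp
  qed
  \<comment> \<open>Multiply the equation for \<delta> by \<gamma> and replace
    \<open>\<gamma> * (x + y - 1)\<close> by \<open>x * y\<close>.\<close>
  with cXY have "(x * y) * (2 * \<gamma> * \<delta>) = (x * y) * (\<gamma> + \<delta>)" by algebra
  with x0 y0 have harm: "2 * \<gamma> * \<delta> = \<gamma> + \<delta>" by simp
  have "\<gamma> \<noteq> 0" "\<gamma> \<noteq> 1" using assms(1,2) by (auto simp: c v_def)
  \<comment> \<open>In the harmonic equation, \<delta> = 0 forces \<gamma> = 0, \<delta> = 1 forces
    \<gamma> = 1, and \<delta> = \<gamma> forces \<gamma> to be 0 or 1.\<close>
  moreover from this harm have "\<delta> \<noteq> 0" "\<delta> \<noteq> 1" "\<delta> \<noteq> \<gamma>" by auto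
  ultimately have "harmonic a (a + v) (a + \<gamma> *\<^sub>R v) (a + \<delta> *\<^sub>R v)"
    using harm by (simp add: harmonic_param_iff[OF v])
  then show ?thesis by (simp add: c d v_def)
qed

section \<open>From harmonicity to a small quadrangle\<close>

text \<open>Seen from \<open>a\<close>, \<open>X\<close> is \<open>P\<close> scaled by
  \<open>k\<close> and \<open>Y\<close> is \<open>Z\<close> scaled by \<open>m * t\<close>. The
  equations for \<open>k\<close> and \<open>m\<close> say that \<open>X\<close> lies on
  \<open>bZ\<close> and \<open>Y\<close> on \<open>bP\<close>.\<close>

lemma harm_config_frame:
  fixes a v w :: "'a::real_vector"
  assumes indep: "\<forall>x y. x *\<^sub>R v + y *\<^sub>R w = 0 \<longrightarrow> x = 0 \<and> y = 0"
    and \<delta>: "\<delta> \<noteq> 0" "\<delta> \<noteq> 1" and harm: "2 * \<gamma> * \<delta> = \<gamma> + \<delta>"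
    and t: "t \<noteq> 0" "t \<noteq> 1" and h: "h \<noteq> 0"
    and k: "k * (\<delta> + t * (1 - \<delta>)) = 1" and m: "m * (1 - \<delta> + t * \<delta>) = 1"
  shows "harm_config a (a + v) (a + \<gamma> *\<^sub>R v) (a + \<delta> *\<^sub>R v)
    (a + \<delta> *\<^sub>R v + (t * h) *\<^sub>R w) (a + (k * \<delta>) *\<^sub>R v + (k * (t * h)) *\<^sub>R w)
    (a + (m * (t * \<delta>)) *\<^sub>R v + (m * (t * h)) *\<^sub>R w) (a + \<delta> *\<^sub>R v + h *\<^sub>R w)"
proof -
  note det = collinear_frame_iff[OF indep]
  let ?pt = "\<lambda>x y. a + x *\<^sub>R v + y *\<^sub>R w"
  have nz: "k \<noteq> 0" "m \<noteq> 0" using k m by auto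
  \<comment> \<open>\<open>k = 1\<close> would mean \<open>X = P\<close>, and
    \<open>m * t = 1\<close> would mean \<open>Y = Z\<close>; each determinant below has
    \<open>k - 1\<close> or \<open>m * t - 1\<close> as a factor.\<close>
  have k1: "k \<noteq> 1"
  proof
    assume "k = 1"
    with k have "(1 - t) * (\<delta> - 1) = 0" by (simp add: algebra_simps)
    with \<delta> t show False by simp
  qed
  have mt: "m * t \<noteq> 1"
  proof
    assume "m * t = 1"
    with m have "m * ((1 - t) * (1 - \<delta>)) = 0" by (simp add: algebra_simps)
    with \<delta> t nz show False by simp
  qed
  have PXY: "\<not> collinear {?pt \<delta> (t * h), ?pt (k * \<delta>) (k * (t * h)), ?pt (m * (t * \<delta>)) (m * (t * h))}"
  proof -
    have "(k * \<delta> - \<delta>) * (m * (t * h) - t * h) - (m * (t * \<delta>) - \<delta>) * (k * (t * h) - t * h)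
      = (k - 1) * \<delta> * t * h * m * (1 - t)" by algebra
    also have "\<dots> \<noteq> 0" using k1 \<delta> t h nz by simp
    finally show ?thesis unfolding det by simp
  qed
  have PXZ: "\<not> collinear {?pt \<delta> (t * h), ?pt (k * \<delta>) (k * (t * h)), ?pt \<delta> h}"
  proof -
    have "(k * \<delta> - \<delta>) * (h - t * h) - (\<delta> - \<delta>) * (k * (t * h) - t * h)
      = (k - 1) * \<delta> * h * (1 - t)" by algebra
    also have "\<dots> \<noteq> 0" using k1 \<delta> t h by simp
    finally show ?thesis unfolding det by simp
  qed
  have PYZ: "\<not> collinear {?pt \<delta> (t * h), ?pt (m * (t * \<delta>)) (m * (t * h)), ?pt \<delta> h}"
  proof -
    have "(m * (t * \<delta>) - \<delta>) * (h - t * h) - (\<delta> - \<delta>) * (m * (t * h) - t * h)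
      = (m * t - 1) * \<delta> * h * (1 - t)" by algebra
    also have "\<dots> \<noteq> 0" using mt \<delta> t h by simp
    finally show ?thesis unfolding det by simp
  qed
  have XYZ: "\<not> collinear {?pt (k * \<delta>) (k * (t * h)), ?pt (m * (t * \<delta>)) (m * (t * h)), ?pt \<delta> h}"
  proof -
    have "(m * (t * \<delta>) - k * \<delta>) * (h - k * (t * h)) - (\<delta> - k * \<delta>) * (m * (t * h) - k * (t * h))
      = (m * t - 1) * \<delta> * h * k * (1 - t)" by algebra
    also have "\<dots> \<noteq> 0" using mt \<delta> t h nz by simp
    finally show ?thesis unfolding det by simp
  qed
  have aPX: "collinear {?pt 0 0, ?pt \<delta> (t * h), ?pt (k * \<delta>) (k * (t * h))}"
    unfolding det by simp
  have bPY: "collinear {?pt 1 0, ?pt \<delta> (t * h), ?pt (m * (t * \<delta>)) (m * (t * h))}"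
    unfolding det using m by algebra
  \<comment> \<open>Harmonicity enters here: it makes \<open>XY\<close> pass through
    \<open>c\<close>.\<close>
  have cXY: "collinear {?pt \<gamma> 0, ?pt (k * \<delta>) (k * (t * h)), ?pt (m * (t * \<delta>)) (m * (t * h))}"
    unfolding det using k m harm by algebra
  have aYZ: "collinear {?pt 0 0, ?pt (m * (t * \<delta>)) (m * (t * h)), ?pt \<delta> h}"
    unfolding det by simp
  have bXZ: "collinear {?pt 1 0, ?pt (k * \<delta>) (k * (t * h)), ?pt \<delta> h}"
    unfolding det using k by algebra
  have dPZ: "collinear {?pt \<delta> 0, ?pt \<delta> (t * h), ?pt \<delta> h}"
    unfolding det by simp
  have abP: "\<not> collinear {?pt 0 0, ?pt 1 0, ?pt \<delta> (t * h)}"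
    unfolding det using t h by simp
  show ?thesis
    unfolding harm_config_def
    using PXY PXZ PYZ XYZ aPX bPY cXY aYZ bXZ dPZ abP unfolding scaleR_zero_left scaleR_one add_0_right
    by blast
qed

text \<open>Since the whole quadrangle shrinks to \<open>d\<close>, any neighbourhood of
  \<open>d\<close> suffices, wherever \<open>a\<close>, \<open>b\<close> and \<open>c\<close>
  lie.\<close>

lemma harmonic_imp_quadrangle:
  fixes a b c d :: "'a::euclidean_space"
  assumes dim: "DIM('a) \<ge> 2" and harmonic: "harmonic a b c d" and U: "open U" "d \<in> U"
  shows "\<exists>P\<in>U. \<exists>X\<in>U. \<exists>Y\<in>U. \<exists>Z\<in>U. harm_config a b c d P X Y Z"
proof -
  define v where "v = b - a"
  have v: "v \<noteq> 0" and ne: "a \<noteq> b" using harmonic by (auto simp: v_def harmonic_def)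
  have coll: "collinear {a, b, c}" "collinear {a, b, d}"
    using harmonic by (auto simp: harmonic_def intro: collinear_subset)
  obtain \<gamma> where "c = a + \<gamma> *\<^sub>R (b - a)" using coll(1) ne by (rule collinear_3_param)
  then have c: "c = a + \<gamma> *\<^sub>R v" by (simp add: v_def)
  obtain \<delta> where "d = a + \<delta> *\<^sub>R (b - a)" using coll(2) ne by (rule collinear_3_param)
  then have d: "d = a + \<delta> *\<^sub>R v" by (simp add: v_def)
  have b: "b = a + v" by (simp add: v_def)
  have \<delta>: "\<delta> \<noteq> 0" "\<delta> \<noteq> 1" and harm: "2 * \<gamma> * \<delta> = \<gamma> + \<delta>"
    using harmonic unfolding b c d harmonic_param_iff[OF v] by auto
  \<comment> \<open>Dimension at least 2 supplies a point off the line \<open>ab\<close>, hence a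
    second frame direction.\<close>
  have "\<not> collinear (UNIV :: 'a set)"
    using dim by (simp add: collinear_aff_dim)
  then have "\<not> UNIV \<subseteq> {a + s *\<^sub>R v |s. True}"
    unfolding collinear_alt by blast
  then obtain p where p: "p \<noteq> a + s *\<^sub>R v" for s by blast
  have nc: "\<not> collinear {a, b, p}"
    using p ne by (auto simp: v_def elim: collinear_3_param)
  define w where "w = p - a"
  note indep = not_collinear_imp_frame[OF nc, folded v_def w_def]
  \<comment> \<open>One parameter drives both limits: \<open>t = 1 - e\<close> and
    \<open>h = e\<close>. Both denominators are 1 at \<open>e = 0\<close>.\<close>
  define k m where "k = (\<lambda>e. 1 / (\<delta> + (1 - e) * (1 - \<delta>)))" and "m = (\<lambda>e. 1 / (1 - \<delta> + (1 - e) * \<delta>))"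
  define P X Y Z where "P = (\<lambda>e. a + \<delta> *\<^sub>R v + ((1 - e) * e) *\<^sub>R w)"
    and "X = (\<lambda>e. a + (k e * \<delta>) *\<^sub>R v + (k e * ((1 - e) * e)) *\<^sub>R w)"
    and "Y = (\<lambda>e. a + (m e * ((1 - e) * \<delta>)) *\<^sub>R v + (m e * ((1 - e) * e)) *\<^sub>R w)"
    and "Z = (\<lambda>e. a + \<delta> *\<^sub>R v + e *\<^sub>R w)"
  have "((\<lambda>e. \<delta> + (1 - e) * (1 - \<delta>)) \<longlongrightarrow> \<delta> + (1 - 0) * (1 - \<delta>)) (at 0)"
    by (intro tendsto_intros)
  then have D1: "((\<lambda>e. \<delta> + (1 - e) * (1 - \<delta>)) \<longlongrightarrow> 1) (at 0)" by simp
  have "((\<lambda>e. 1 - \<delta> + (1 - e) * \<delta>) \<longlongrightarrow> 1 - \<delta> + (1 - 0) * \<delta>) (at 0)"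
    by (intro tendsto_intros)
  then have D2: "((\<lambda>e. 1 - \<delta> + (1 - e) * \<delta>) \<longlongrightarrow> 1) (at 0)" by simp
  have k: "(k \<longlongrightarrow> 1) (at 0)" using tendsto_divide[OF tendsto_const D1, of 1] by (simp add: k_def)
  have m: "(m \<longlongrightarrow> 1) (at 0)" using tendsto_divide[OF tendsto_const D2, of 1] by (simp add: m_def)
  have "(P \<longlongrightarrow> a + \<delta> *\<^sub>R v + ((1 - 0) * 0) *\<^sub>R w) (at 0)"
    "(X \<longlongrightarrow> a + (1 * \<delta>) *\<^sub>R v + (1 * ((1 - 0) * 0)) *\<^sub>R w) (at 0)"
    "(Y \<longlongrightarrow> a + (1 * ((1 - 0) * \<delta>)) *\<^sub>R v + (1 * ((1 - 0) * 0)) *\<^sub>R w) (at 0)"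
    "(Z \<longlongrightarrow> a + \<delta> *\<^sub>R v + 0 *\<^sub>R w) (at 0)"
    unfolding P_def X_def Y_def Z_def by (intro tendsto_intros k m)+
  then have lim: "(P \<longlongrightarrow> d) (at 0)" "(X \<longlongrightarrow> d) (at 0)" "(Y \<longlongrightarrow> d) (at 0)" "(Z \<longlongrightarrow> d) (at 0)"
    by (simp_all add: d)
  \<comment> \<open>The punctured filter gives \<open>h \<noteq> 0\<close> and
    \<open>t \<noteq> 1\<close>; \<open>e \<noteq> 1\<close> gives
    \<open>t \<noteq> 0\<close>.\<close>
  have "\<forall>\<^sub>F e in at (0::real). e \<noteq> 0" by (simp add: eventually_at_filter)
  moreover have "\<forall>\<^sub>F e in at (0::real). e \<noteq> 1"
    by (rule tendsto_imp_eventually_ne[OF tendsto_ident_at]) simp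
  moreover have "\<forall>\<^sub>F e in at 0. \<delta> + (1 - e) * (1 - \<delta>) \<noteq> 0" "\<forall>\<^sub>F e in at 0. 1 - \<delta> + (1 - e) * \<delta> \<noteq> 0"
    by (rule tendsto_imp_eventually_ne[OF D1], simp) (rule tendsto_imp_eventually_ne[OF D2], simp)
  moreover note lim[THEN topological_tendstoD, OF U]
  ultimately have "\<forall>\<^sub>F e in at 0. e \<noteq> 0 \<and> e \<noteq> 1 \<and> \<delta> + (1 - e) * (1 - \<delta>) \<noteq> 0 \<and>
      1 - \<delta> + (1 - e) * \<delta> \<noteq> 0 \<and> P e \<in> U \<and> X e \<in> U \<and> Y e \<in> U \<and> Z e \<in> U"
    by (simp add: eventually_conj_iff)
  then obtain e where e: "e \<noteq> 0" "e \<noteq> 1" "\<delta> + (1 - e) * (1 - \<delta>) \<noteq> 0" "1 - \<delta> + (1 - e) * \<delta> \<noteq> 0"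
    and in_U: "P e \<in> U" "X e \<in> U" "Y e \<in> U" "Z e \<in> U"
    using eventually_happens'[OF at_neq_bot] by blast
  have "harm_config a b c d (P e) (X e) (Y e) (Z e)"
    unfolding b c d P_def X_def Y_def Z_def
    by (rule harm_config_frame[OF indep \<delta> harm]) (use e in \<open>simp_all add: k_def m_def\<close>)
  with in_U show ?thesis by blast
qed

theorem theorem9p3:
  fixes K :: "(real ^ 'n) set"
  assumes "CARD('n) \<ge> 2"
    and "convex K"
    and "interior K \<noteq> {}"
  shows "(\<forall>a\<in>interior K. \<forall>b\<in>interior K. \<forall>c\<in>interior K. \<forall>d\<in>interior K.
            harmonic a b c d \<longrightarrow>
              models K Harm [a, b, c, d] \<and>
              (\<exists>P\<in>interior K. \<exists>X\<in>interior K. \<exists>Y\<in>interior K. \<exists>Z\<in>interior K.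
                 models K Harm_matrix [a, b, c, d, P, X, Y, Z])) \<and>
         (\<forall>a\<in>interior K. \<forall>b\<in>interior K. \<forall>c\<in>interior K. \<forall>d\<in>interior K.
            collinear {a, b, c, d} \<longrightarrow>
              (models K Harm [a, b, c, d] \<longleftrightarrow> harmonic a b c d))"
proof -
  have witnesses: "\<exists>P\<in>interior K. \<exists>X\<in>interior K. \<exists>Y\<in>interior K. \<exists>Z\<in>interior K.
      harm_config a b c d P X Y Z"
    if "harmonic a b c d" "d \<in> interior K" for a b c d
    using that assms(1) by (intro harmonic_imp_quadrangle) auto
  have models: "models K Harm [a, b, c, d]" if "harmonic a b c d" "d \<in> interior K" for a b c d
  proof -
    have "a \<noteq> b \<and> c \<noteq> a \<and> c \<noteq> b \<and> collinear {a, b, c} \<and> collinear {a, b, d}"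
      using that(1) by (auto simp: harmonic_def intro: collinear_subset)
    then show ?thesis
      unfolding models_Harm using witnesses[OF that] interior_subset[of K] by blast
  qed
  \<comment> \<open>The quantifiers of \<open>Harm\<close> range over all of \<open>K\<close>, and
    the converse accepts witnesses anywhere, boundary points included.\<close>
  have "harmonic a b c d" if "models K Harm [a, b, c, d]" for a b c d
    using that unfolding models_Harm by (blast intro: quadrangle_imp_harmonic)
  with models witnesses show ?thesis
    unfolding models_Harm_matrix by blast
qed

end
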